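(* Let $g_1, \ldots, g_n$ be positions in impartial games, each of which is a one-move game. Then $$\mathcal{G}(C_{(+, \mathrm{pass})}(g_1, \ldots, g_n)) = \mathcal{G}\big(C^{\mathrm{nim}}_{(+, \mathrm{pass})}(\mathcal{G}(g_1), \ldots, \mathcal{G}(g_n))\big).$$
   Context: All games are impartial two-player games under normal play: the player with no legal move loses. Every game is finite, i.e. each position has finitely many options and every play terminates. For a position $g$, $\mathrm{move}(g)$ denotes its set of options, i.e. the positions reachable in one move. A follower of $g$ is any position reachable from $g$ by a sequence of zero or more moves, so $g$ is a follower of itself. A terminal position is one with no options. The Sprague–Grundy value is defined recursively by $\mathcal{G}(g)=\mathrm{mex}\{\mathcal{G}(h): h\in\mathrm{move}(g)\}$, where $\mathrm{mex}(S)$ is the least nonnegative integer not in $S$. The disjunctive compound $C_+(g_1,\dots,g_n)$ has as options exactly the positions $C_+(g_1',\dots,g_n')$ such that, for some $i$, $g_i'\in\mathrm{move}(g_i)$ and $g_j'=g_j$ for all $j\neq i$. The one-pass compound $C_{(+,\mathrm{pass})}(g_1,\dots,g_n)$ is defined as follows. - If every $g_i$ is terminal, it has no options. - Otherwise, its options are all $C_{(+,\mathrm{pass})}(g_1',\dots,g_n')$ such that, for some $i$, $g_i'\in\mathrm{move}(g_i)$ and $g_j'=g_j$ for $j\ne i$, together with the single further option $C_+(g_1,\dots,g_n)$. This last option is the pass move. A position $g$ is a one-move game if, for every follower $g'$ of $g$, $\mathcal{G}(g')=0$ if and only if $g'$ is terminal. For nonnegative integers $m_1,\dots,m_n$, $C^{\mathrm{nim}}_{(+,\mathrm{pass})}(m_1,\dots,m_n)$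 denotes the one-pass compound whose $i$-th component is single-pile Nim with $m_i$ tokens. In single-pile Nim with $m$ tokens, the options are single piles with $m'$ tokens for each $0\le m'<m$. *)

theory Defs
  imports Main
begin

text \<open>
  A game is given by its option function \<open>mv\<close>, mapping a position to the set of its options.
\<close>

definition impartial_game :: "('a \<Rightarrow> 'a set) \<Rightarrow> bool" where
  "impartial_game mv \<longleftrightarrow> (\<forall>g. finite (mv g)) \<and> wf {(h, g). h \<in> mv g}"

definition terminal :: "('a \<Rightarrow> 'a set) \<Rightarrow> 'a \<Rightarrow> bool" where
  "terminal mv g \<longleftrightarrow> mv g = {}"

definition follower :: "('a \<Rightarrow> 'a set) \<Rightarrow> 'a \<Rightarrow> 'a \<Rightarrow> bool" where
  "follower mv g h \<longleftrightarrow> (\<lambda>x y. y \<in> mv x)\<^sup>*\<^sup>* g h"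

definition mex :: "nat set \<Rightarrow> nat" where
  "mex S = (LEAST n. n \<notin> S)"

text \<open>Meaningful for \<^const>\<open>impartial_game\<close>s only; see \<open>grundy_rec\<close> below.\<close>

definition grundy :: "('a \<Rightarrow> 'a set) \<Rightarrow> 'a \<Rightarrow> nat" where
  "grundy mv = wfrec {(h, g). h \<in> mv g} (\<lambda>G g. mex (G ` mv g))"

definition one_move_game :: "('a \<Rightarrow> 'a set) \<Rightarrow> 'a \<Rightarrow> bool" where
  "one_move_game mv g \<longleftrightarrow>
     (\<forall>h. follower mv g h \<longrightarrow> (grundy mv h = 0 \<longleftrightarrow> terminal mv h))"

text \<open>
  The components of a compound are indexed by a finite type \<open>'n\<close>. Each component has its own
  option function; components with different kinds of positions are covered by taking \<open>'a\<close>
  to be a sum type.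
\<close>

definition disj_moves :: "('n \<Rightarrow> 'a \<Rightarrow> 'a set) \<Rightarrow> ('n \<Rightarrow> 'a) \<Rightarrow> ('n \<Rightarrow> 'a) set" where
  "disj_moves mv g = {g(i := h) | i h. h \<in> mv i (g i)}"

text \<open>
  \<open>Pass_Available g\<close> is the one-pass compound of the components \<open>g\<close>; \<open>Pass_Used g\<close> is the
  position reached from it by the pass move, which is a copy of the disjunctive compound of \<open>g\<close>
  (see \<open>grundy_Pass_Used\<close>).
\<close>

datatype 'p one_pass_position = Pass_Available 'p | Pass_Used 'p

primrec one_pass_moves ::
  "('n \<Rightarrow> 'a \<Rightarrow> 'a set) \<Rightarrow> ('n \<Rightarrow> 'a) one_pass_position \<Rightarrow> ('n \<Rightarrow> 'a) one_pass_position set" where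
  "one_pass_moves mv (Pass_Available g) =
     (if \<forall>i. terminal (mv i) (g i) then {}
      else Pass_Available ` disj_moves mv g \<union> {Pass_Used g})"
| "one_pass_moves mv (Pass_Used g) = Pass_Used ` disj_moves mv g"

definition nim_moves :: "nat \<Rightarrow> nat set" where
  "nim_moves m = {m'. m' < m}"

lemma grundy_rec:
  assumes "impartial_game mv"
  shows "grundy mv g = mex (grundy mv ` mv g)"
proof -
  let ?R = "{(h, g). h \<in> mv g}"
  have wf: "wf ?R" using assms by (simp add: impartial_game_def)
  have "grundy mv g = mex (cut (grundy mv) ?R g ` mv g)"
    unfolding grundy_def by (subst wfrec[OF wf]) simp
  also have "cut (grundy mv) ?R g ` mv g = grundy mv ` mv g"
    by (rule image_cong) (auto simp: cut_apply)
  finally show ?thesis .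
qed

lemma impartial_game_rank:
  assumes "impartial_game mv"
  obtains r :: "'a \<Rightarrow> nat" where "\<And>g h. h \<in> mv g \<Longrightarrow> r h < r g"
proof -
  let ?R = "{(h, g). h \<in> mv g}"
  define r where "r = wfrec ?R (\<lambda>r g. \<Sum>h\<in>mv g. Suc (r h))"
  have wf: "wf ?R" and fin: "\<And>g. finite (mv g)" using assms by (auto simp: impartial_game_def)
  have rec: "r g = (\<Sum>h\<in>mv g. Suc (r h))" for g
  proof -
    have "r g = (\<Sum>h\<in>mv g. Suc (cut r ?R g h))"
      unfolding r_def by (subst wfrec[OF wf]) simp
    also have "\<dots> = (\<Sum>h\<in>mv g. Suc (r h))"
      by (rule sum.cong) (auto simp: cut_apply)
    finally show ?thesis .
  qed
  have "r h < r g" if "h \<in> mv g" for g h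
  proof -
    have "Suc (r h) \<le> (\<Sum>h\<in>mv g. Suc (r h))"
      by (rule member_le_sum[OF that]) (auto simp: fin)
    then show ?thesis using rec[of g] by simp
  qed
  then show ?thesis using that by blast
qed

lemma finite_disj_moves:
  fixes mv :: "'n::finite \<Rightarrow> 'a \<Rightarrow> 'a set"
  assumes "\<And>i. impartial_game (mv i)"
  shows "finite (disj_moves mv g)"
proof -
  have "disj_moves mv g = (\<Union>i. (\<lambda>h. g(i := h)) ` mv i (g i))"
    by (auto simp: disj_moves_def)
  then show ?thesis using assms by (simp add: impartial_game_def)
qed

lemma disj_moves_rank:
  fixes mv :: "'n::finite \<Rightarrow> 'a \<Rightarrow> 'a set"
  assumes "\<And>i. impartial_game (mv i)"
  shows "\<exists>R :: ('n \<Rightarrow> 'a) \<Rightarrow> nat. \<forall>g h. h \<in> disj_moves mv g \<longrightarrow> R h < R g"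
proof -
  have "\<exists>r :: 'a \<Rightarrow> nat. \<forall>g h. h \<in> mv i g \<longrightarrow> r h < r g" for i
    by (rule impartial_game_rank[OF assms[of i]]) blast
  then obtain r :: "'n \<Rightarrow> 'a \<Rightarrow> nat" where r: "\<And>i g h. h \<in> mv i g \<Longrightarrow> r i h < r i g"
    by metis
  have "(\<Sum>i\<in>UNIV. r i (h i)) < (\<Sum>i\<in>UNIV. r i (g i))" if "h \<in> disj_moves mv g" for g h
  proof -
    from that obtain i x where h: "h = g(i := x)" and x: "x \<in> mv i (g i)"
      by (auto simp: disj_moves_def)
    show ?thesis
      by (rule sum_strict_mono_ex1) (auto simp: h r[OF x] intro!: less_imp_le exI[of _ i])
  qed
  then show ?thesis by (intro exI[of _ "\<lambda>g. \<Sum>i\<in>UNIV. r i (g i)"]) blast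
qed

lemma impartial_game_disj_moves:
  fixes mv :: "'n::finite \<Rightarrow> 'a \<Rightarrow> 'a set"
  assumes "\<And>i. impartial_game (mv i)"
  shows "impartial_game (disj_moves mv)"
proof -
  obtain R :: "('n \<Rightarrow> 'a) \<Rightarrow> nat" where R: "\<And>g h. h \<in> disj_moves mv g \<Longrightarrow> R h < R g"
    using disj_moves_rank[of mv, OF assms] by blast
  then have "wf {(h, g). h \<in> disj_moves mv g}"
    by (intro wf_subset[OF wf_measure[of R]]) auto
  then show ?thesis using finite_disj_moves[of mv, OF assms] by (simp add: impartial_game_def)
qed

lemma impartial_game_one_pass_moves:
  fixes mv :: "'n::finite \<Rightarrow> 'a \<Rightarrow> 'a set"
  assumes "\<And>i. impartial_game (mv i)"
  shows "impartial_game (one_pass_moves mv)"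
proof -
  obtain R :: "('n \<Rightarrow> 'a) \<Rightarrow> nat" where R: "\<And>g h. h \<in> disj_moves mv g \<Longrightarrow> R h < R g"
    using disj_moves_rank[of mv, OF assms] by blast
  define Q where
    "Q p = (case p of Pass_Available g \<Rightarrow> Suc (2 * R g) | Pass_Used g \<Rightarrow> 2 * R g)" for p
  have "Q q < Q p" if "q \<in> one_pass_moves mv p" for p q
    using that by (cases p) (auto simp: Q_def R split: if_splits)
  then have "wf {(q, p). q \<in> one_pass_moves mv p}"
    by (intro wf_subset[OF wf_measure[of Q]]) auto
  moreover have "finite (one_pass_moves mv p)" for p
    by (cases p) (auto simp: finite_disj_moves[of mv, OF assms])
  ultimately show ?thesis by (simp add: impartial_game_def)
qed

lemma impartial_game_nim_moves: "impartial_game nim_moves"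
  using wf_less by (simp add: impartial_game_def nim_moves_def)

lemma grundy_Pass_Used:
  fixes mv :: "'n::finite \<Rightarrow> 'a \<Rightarrow> 'a set"
  assumes "\<And>i. impartial_game (mv i)"
  shows "grundy (one_pass_moves mv) (Pass_Used g) = grundy (disj_moves mv) g"
proof -
  have D: "impartial_game (disj_moves mv)" and P: "impartial_game (one_pass_moves mv)"
    using assms by (rule impartial_game_disj_moves, rule impartial_game_one_pass_moves)
  have "wf {(h, g). h \<in> disj_moves mv g}" using D by (simp add: impartial_game_def)
  then show ?thesis
  proof (induction g rule: wf_induct_rule)
    case (less g)
    then have "(\<lambda>h. grundy (one_pass_moves mv) (Pass_Used h)) ` disj_moves mv g
        = grundy (disj_moves mv) ` disj_moves mv g"
      by (intro image_cong) auto
    then show ?case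
      by (simp add: grundy_rec[OF P, of "Pass_Used g"] grundy_rec[OF D, of g] image_image)
  qed
qed

end

theory Submission
  imports Defs
begin

text \<open>
  Replacing every component by its Sprague--Grundy value maps the one-pass compound to one-pass
  Nim. Every Nim move lifts along this map. Conversely, a move either maps to a Nim move or raises
  the value of a component, in which case Nim can move back; so its image has a value different from
  that of the current position and does not affect the mex. The one-move condition ensures that
  both compounds allow the pass move at the same time.
\<close>

lemma mex_notin:
  assumes "finite S"
  shows "mex S \<notin> S"
  unfolding mex_def using ex_new_if_finite[OF infinite_UNIV_nat assms] by (rule LeastI_ex)

lemma less_mex_in: "n < mex S \<Longrightarrow> n \<in> S"
  unfolding mex_def using not_less_Least by blast

lemma mex_eqI:
  assumes "m \<notin> S" and "\<And>n. n < m \<Longrightarrow> n \<in> S"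
  shows "mex S = m"
  unfolding mex_def using assms by (intro Least_equality) (auto simp: not_less[symmetric])

lemma grundy_option_neq:
  assumes "impartial_game mv" and "h \<in> mv g"
  shows "grundy mv h \<noteq> grundy mv g"
proof -
  have "mex (grundy mv ` mv g) \<notin> grundy mv ` mv g"
    using assms(1) by (intro mex_notin) (simp add: impartial_game_def)
  then show ?thesis using assms(2) grundy_rec[OF assms(1), of g] by force
qed

lemma less_grundy_obtain_option:
  assumes "impartial_game mv" and "n < grundy mv g"
  obtains h where "h \<in> mv g" and "grundy mv h = n"
  using less_mex_in[of n "grundy mv ` mv g"] assms(2) grundy_rec[OF assms(1), of g] by auto

text \<open>Well-founded induction on \<open>p\<close>: \<open>lift\<close> makes every smaller
  value occur among the options, and \<open>reversible\<close> keeps the value of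
  \<open>\<phi> p\<close> itself from occurring. The invariant \<open>P\<close> confines both
  conditions to a family of positions closed under moves, since \<open>\<phi>\<close> may behave
  badly elsewhere.\<close>

lemma grundy_eq_of_reversible_map:
  assumes mv: "impartial_game mv" and mv': "impartial_game mv'"
    and closed: "\<And>p q. P p \<Longrightarrow> q \<in> mv p \<Longrightarrow> P q"
    and lift: "\<And>p q'. P p \<Longrightarrow> q' \<in> mv' (\<phi> p) \<Longrightarrow> \<exists>q\<in>mv p. \<phi> q = q'"
    and reversible: "\<And>p q. P p \<Longrightarrow> q \<in> mv p \<Longrightarrow> \<phi> q \<in> mv' (\<phi> p) \<or> \<phi> p \<in> mv' (\<phi> q)"
    and "P p"
  shows "grundy mv p = grundy mv' (\<phi> p)"
proof -
  have "wf {(h, g). h \<in> mv g}" using mv by (simp add: impartial_game_def)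
  then show ?thesis using \<open>P p\<close>
  proof (induction p rule: wf_induct_rule)
    case (less p)
    have IH: "grundy mv q = grundy mv' (\<phi> q)" if "q \<in> mv p" for q
      using less that closed by blast
    have "mex (grundy mv ` mv p) = grundy mv' (\<phi> p)"
    proof (rule mex_eqI)
      \<comment> \<open>By induction an option \<open>q\<close> has the value of
        \<open>\<phi> q\<close>. A move joins \<open>\<phi> q\<close> and \<open>\<phi> p\<close> in
        one direction or the other, so their values differ.\<close>
      show "grundy mv' (\<phi> p) \<notin> grundy mv ` mv p"
        using IH reversible[OF less.prems] grundy_option_neq[OF mv'] by (metis imageE)
    next
      fix n assume "n < grundy mv' (\<phi> p)"
      then obtain q' where "q' \<in> mv' (\<phi> p)" "grundy mv' q' = n"
        by (rule less_grundy_obtain_option[OF mv'])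
      then show "n \<in> grundy mv ` mv p"
        using lift[OF less.prems] IH by (metis imageI)
    qed
    then show ?case by (simp add: grundy_rec[OF mv, of p])
  qed
qed

lemma one_move_game_option:
  "one_move_game mv g \<Longrightarrow> h \<in> mv g \<Longrightarrow> one_move_game mv h"
  by (auto simp: one_move_game_def follower_def intro: converse_rtranclp_into_rtranclp)

lemma one_move_game_grundy_eq_0_iff:
  "one_move_game mv g \<Longrightarrow> grundy mv g = 0 \<longleftrightarrow> terminal mv g"
  by (simp add: one_move_game_def follower_def)

lemma one_move_games_disj_moves:
  assumes "\<And>i. one_move_game (mv i) (g i)" and "h \<in> disj_moves mv g"
  shows "one_move_game (mv i) (h i)"
  using assms one_move_game_option[OF assms(1)] by (fastforce simp: disj_moves_def)

lemma terminal_nim_moves_iff: "terminal nim_moves m \<longleftrightarrow> m = 0"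
  by (auto simp: terminal_def nim_moves_def)

abbreviation (input) component_values :: "('n \<Rightarrow> 'a \<Rightarrow> 'a set) \<Rightarrow> ('n \<Rightarrow> 'a) \<Rightarrow> 'n \<Rightarrow> nat" where
  "component_values mv g \<equiv> \<lambda>i. grundy (mv i) (g i)"

lemma component_values_fun_upd:
  "component_values mv (g(i := x)) = (component_values mv g)(i := grundy (mv i) x)"
  by auto

text \<open>By the mex rule, component \<open>i\<close> has an option of every value below its own,
  so shrinking pile \<open>i\<close> is the image of a move in that component.\<close>

lemma disj_nim_move_lift:
  assumes "\<And>i. impartial_game (mv i)"
    and "m \<in> disj_moves (\<lambda>_. nim_moves) (component_values mv g)"
  shows "\<exists>h\<in>disj_moves mv g. component_values mv h = m"
proof -
  obtain i n where m: "m = (component_values mv g)(i := n)" and "n < grundy (mv i) (g i)"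
    using assms(2) by (auto simp: disj_moves_def nim_moves_def)
  then obtain x where "x \<in> mv i (g i)" "grundy (mv i) x = n"
    using less_grundy_obtain_option[OF assms(1)] by blast
  then show ?thesis
    by (intro bexI[of _ "g(i := x)"]) (auto simp: m disj_moves_def)
qed

text \<open>Only component \<open>i\<close> changes, and its value does change. A pile can be
  lowered to any smaller size, so Nim can move from the side with the larger pile to the
  other.\<close>

lemma disj_move_reversible:
  assumes "\<And>i. impartial_game (mv i)" and "h \<in> disj_moves mv g"
  shows "component_values mv h \<in> disj_moves (\<lambda>_. nim_moves) (component_values mv g) \<or>
         component_values mv g \<in> disj_moves (\<lambda>_. nim_moves) (component_values mv h)"
proof -
  obtain i x where h: "h = g(i := x)" and x: "x \<in> mv i (g i)"
    using assms(2) by (auto simp: disj_moves_def)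
  have nim: "m(i := n) \<in> disj_moves (\<lambda>_. nim_moves) m" if "n < m i" for m n
    using that by (auto simp: disj_moves_def nim_moves_def)
  have "grundy (mv i) x \<noteq> grundy (mv i) (g i)"
    using assms(1) x by (rule grundy_option_neq)
  then consider "grundy (mv i) x < component_values mv g i"
    | "grundy (mv i) (g i) < component_values mv h i"
    unfolding h by (metis fun_upd_same nat_neq_iff)
  then show ?thesis
  proof cases
    case 1
    then show ?thesis unfolding h component_values_fun_upd by (intro disjI1 nim)
  next
    case 2
    have "component_values mv g = (component_values mv h)(i := grundy (mv i) (g i))"
      by (auto simp: h)
    then show ?thesis using nim[of _ "component_values mv h", OF 2] by metis
  qed
qed

text \<open>This discharges the guard in \<open>one_pass_moves\<close> at any position from which an
  ordinary move is known.\<close>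

lemma disj_moves_nonterminal:
  "h \<in> disj_moves mv g \<Longrightarrow> \<not> (\<forall>i. terminal (mv i) (g i))"
  by (auto simp: disj_moves_def terminal_def)

theorem theorem5:
  fixes mv :: "'n::finite \<Rightarrow> 'a \<Rightarrow> 'a set" and g :: "'n \<Rightarrow> 'a"
  assumes "\<And>i. impartial_game (mv i)"
    and "\<And>i. one_move_game (mv i) (g i)"
  shows "grundy (one_pass_moves mv) (Pass_Available g) =
         grundy (one_pass_moves (\<lambda>_. nim_moves)) (Pass_Available (\<lambda>i. grundy (mv i) (g i)))"
proof -
  let ?nim = "\<lambda>_ :: 'n. nim_moves"
  let ?V = "component_values mv"
  \<comment> \<open>The datatype map keeps the constructor, so the pass status is preserved and a
    pass move is sent to a pass move.\<close>
  let ?\<phi> = "map_one_pass_position ?V"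
  \<comment> \<open>\<open>set_one_pass_position p\<close> is the singleton of the tuple stored in
    \<open>p\<close>, so one formula covers both pass states.\<close>
  define P where "P p \<longleftrightarrow> (\<forall>h\<in>set_one_pass_position p. \<forall>i. one_move_game (mv i) (h i))" for p
  have terminal_iff: "(\<forall>i. terminal nim_moves (?V h i)) \<longleftrightarrow> (\<forall>i. terminal (mv i) (h i))"
    if "\<forall>i. one_move_game (mv i) (h i)" for h
    using that by (simp add: terminal_nim_moves_iff one_move_game_grundy_eq_0_iff)
  have "grundy (one_pass_moves mv) (Pass_Available g) =
        grundy (one_pass_moves ?nim) (?\<phi> (Pass_Available g))"
  proof (rule grundy_eq_of_reversible_map[where P = P])
    show "impartial_game (one_pass_moves mv)"
      using assms(1) by (rule impartial_game_one_pass_moves)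
    show "impartial_game (one_pass_moves ?nim)"
      using impartial_game_nim_moves by (rule impartial_game_one_pass_moves)
    show "P (Pass_Available g)" using assms(2) by (simp add: P_def)
  next
    fix p q assume "P p" "q \<in> one_pass_moves mv p"
    then show "P q"
      by (cases p) (auto simp: P_def split: if_splits intro: one_move_games_disj_moves)
  next
    fix p q' assume "P p" and q': "q' \<in> one_pass_moves ?nim (?\<phi> p)"
    show "\<exists>q\<in>one_pass_moves mv p. ?\<phi> q = q'"
    proof (cases p)
      case (Pass_Available h)
      \<comment> \<open>Nim has the option \<open>q'\<close>, so not all piles are empty. By
        \<open>terminal_iff\<close> the original compound can pass too, which is what lifts a Nim
        pass.\<close>
      then have "\<not> (\<forall>i. terminal (mv i) (h i))"
        using \<open>P p\<close> q' terminal_iff[of h] by (auto simp: P_def split: if_splits)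
      then show ?thesis
        using q' Pass_Available disj_nim_move_lift[of mv _ h, OF assms(1)]
        by (fastforce split: if_splits)
    next
      case (Pass_Used h)
      then show ?thesis using q' disj_nim_move_lift[of mv _ h, OF assms(1)] by fastforce
    qed
  next
    fix p q assume "P p" and q: "q \<in> one_pass_moves mv p"
    show "?\<phi> q \<in> one_pass_moves ?nim (?\<phi> p) \<or> ?\<phi> p \<in> one_pass_moves ?nim (?\<phi> q)"
    proof (cases p)
      case (Pass_Available h)
      then have nim_nonterminal: "\<not> (\<forall>i. terminal nim_moves (?V h i))"
        using \<open>P p\<close> q terminal_iff[of h] by (auto simp: P_def split: if_splits)
      consider "q = Pass_Used h" | h' where "q = Pass_Available h'" "h' \<in> disj_moves mv h"
        using q Pass_Available by (auto split: if_splits)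
      then show ?thesis
      proof cases
        case 1
        then show ?thesis using Pass_Available nim_nonterminal by auto
      next
        case 2
        \<comment> \<open>If the Nim move runs backwards, it starts at the image of
          \<open>h'\<close>. The move itself shows that this image is not terminal, so it is an
          option of the one-pass compound as well.\<close>
        from disj_move_reversible[OF assms(1) 2(2)] show ?thesis
          using 2(1) Pass_Available by (auto dest: disj_moves_nonterminal)
      qed
    next
      case (Pass_Used h)
      then show ?thesis using q disj_move_reversible[OF assms(1)] by fastforce
    qed
  qed
  then show ?thesis by simp
qed

end
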